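(* Let $X$ be a real-valued centered Gaussian process on $[0,1]$ with continuous sample paths and covariance $R(s,t)=\mathbb{E}(X_sX_t)$, and let $\mathcal{H}$ be its Cameron-Martin space. Let $\rho\ge1$. If $R$ is of finite $\rho$-variation, then $\mathcal{H}\subset C^{\rho\text{-var}}([0,1],\mathbb{R})$. More precisely, for all $h\in\mathcal{H}$ and all $s<t$ in $[0,1]$, $$|h|_{\rho\text{-var};[s,t]}\le\sqrt{\langle h,h\rangle_{\mathcal{H}}}\,\sqrt{|R|_{\rho\text{-var};[s,t]^{2}}}.$$
   Context: The Cameron-Martin space $\mathcal{H}\subset C([0,1])$ consists of the paths $t\mapsto h_t=\mathbb{E}(ZX_t)$, where $Z$ ranges over the Gaussian random variables in the closed linear span of $\{X_t:t\in[0,1]\}$ in $L^2$; if $h=\mathbb{E}(ZX_\cdot)$ and $h'=\mathbb{E}(Z'X_\cdot)$ then $\langle h,h'\rangle_{\mathcal{H}}=\mathbb{E}(ZZ')$. $|h|_{\rho\text{-var};[s,t]}=\sup_{(t_i)}(\sum_i|h_{t_{i+1}}-h_{t_i}|^\rho)^{1/\rho}$ over subdivisions of $[s,t]$, and $C^{\rho\text{-var}}$ is the space of continuous paths with finite $\rho$-variation on $[0,1]$. For $f$ on $[0,1]^2$, the rectangular increment over $[s,t]\times[u,v]$ is $f(s,u)+f(t,v)-f(s,v)-f(t,u)$, and $|f|_{\rho\text{-var};[s,t]\times[u,v]}$ is the supremum, over all subdivisions $(t_i)$ of $[s,t]$ and $(t'_j)$ of $[u,v]$, of $\big(\sum_{i,j}|\text{increment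 of }f\text{ over }[t_i,t_{i+1}]\times[t'_j,t'_{j+1}]|^{\rho}\big)^{1/\rho}$; $f$ is of finite $\rho$-variation if $|f|_{\rho\text{-var};[0,1]^2}<\infty$. *)

theory Defs
  imports "HOL-Probability.Probability"
begin

text \<open>Paths on \<open>[0,1]\<close> are functions \<open>real \<Rightarrow> real\<close> of which only the values on \<open>{0..1}\<close> are used;
  a process is a family \<open>X t\<close> of which only the members with \<open>t \<in> {0..1}\<close> are used.\<close>

text \<open>Degenerate (almost surely constant) Gaussian variables are admitted; they need a separate
  disjunct because they have no Lebesgue density.\<close>

definition gaussian :: "'a measure \<Rightarrow> ('a \<Rightarrow> real) \<Rightarrow> bool" where
  "gaussian M Y \<longleftrightarrow> Y \<in> borel_measurable M \<and>
     ((\<exists>\<mu> \<sigma>. 0 < \<sigma> \<and> distributed M lborel Y (normal_density \<mu> \<sigma>)) \<or>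
      (\<exists>\<mu>. AE \<omega> in M. Y \<omega> = \<mu>))"

definition linear_span :: "(real \<Rightarrow> 'a \<Rightarrow> real) \<Rightarrow> ('a \<Rightarrow> real) set" where
  "linear_span X = {\<lambda>\<omega>. \<Sum>t\<in>T. c t * X t \<omega> | T c. finite T \<and> T \<subseteq> {0..1}}"

definition gaussian_process :: "'a measure \<Rightarrow> (real \<Rightarrow> 'a \<Rightarrow> real) \<Rightarrow> bool" where
  "gaussian_process M X \<longleftrightarrow> (\<forall>Y\<in>linear_span X. gaussian M Y)"

definition covariance :: "'a measure \<Rightarrow> (real \<Rightarrow> 'a \<Rightarrow> real) \<Rightarrow> real \<Rightarrow> real \<Rightarrow> real" where
  "covariance M X s t = (\<integral>\<omega>. X s \<omega> * X t \<omega> \<partial>M)"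

text \<open>Elements of \<open>L\<^sup>2\<close> are represented by functions, not by classes modulo null sets.\<close>

definition closed_linear_span :: "'a measure \<Rightarrow> (real \<Rightarrow> 'a \<Rightarrow> real) \<Rightarrow> ('a \<Rightarrow> real) set" where
  "closed_linear_span M X =
     {Z. Z \<in> borel_measurable M \<and> integrable M (\<lambda>\<omega>. (Z \<omega>)\<^sup>2) \<and>
         (\<forall>\<epsilon>>0. \<exists>Y\<in>linear_span X.
            integrable M (\<lambda>\<omega>. (Y \<omega>)\<^sup>2) \<and> (\<integral>\<omega>. (Z \<omega> - Y \<omega>)\<^sup>2 \<partial>M) < \<epsilon>)}"

definition represents :: "'a measure \<Rightarrow> (real \<Rightarrow> 'a \<Rightarrow> real) \<Rightarrow> ('a \<Rightarrow> real) \<Rightarrow> (real \<Rightarrow> real) \<Rightarrow> bool" where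
  "represents M X Z h \<longleftrightarrow> Z \<in> closed_linear_span M X \<and> gaussian M Z \<and>
     (\<forall>t\<in>{0..1}. h t = (\<integral>\<omega>. Z \<omega> * X t \<omega> \<partial>M))"

definition cameron_martin :: "'a measure \<Rightarrow> (real \<Rightarrow> 'a \<Rightarrow> real) \<Rightarrow> (real \<Rightarrow> real) set" where
  "cameron_martin M X = {h. \<exists>Z. represents M X Z h}"

text \<open>The value does not depend on the representatives: two representatives of the same path differ
  by an element of the closed linear span orthogonal to every \<open>X t\<close>, hence by a null function.\<close>

definition cm_inner ::
  "'a measure \<Rightarrow> (real \<Rightarrow> 'a \<Rightarrow> real) \<Rightarrow> (real \<Rightarrow> real) \<Rightarrow> (real \<Rightarrow> real) \<Rightarrow> real" where
  "cm_inner M X h h' =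
     (THE r. \<exists>Z Z'. represents M X Z h \<and> represents M X Z' h' \<and> r = (\<integral>\<omega>. Z \<omega> * Z' \<omega> \<partial>M))"

text \<open>A pair \<open>(n, p)\<close> stands for the subdivision \<open>s = p 0 < p 1 < \<dots> < p n = t\<close>.\<close>

definition subdivisions :: "real \<Rightarrow> real \<Rightarrow> (nat \<times> (nat \<Rightarrow> real)) set" where
  "subdivisions s t = {(n, p). p 0 = s \<and> p n = t \<and> (\<forall>i<n. p i < p (Suc i))}"

definition var_1d :: "real \<Rightarrow> (real \<Rightarrow> real) \<Rightarrow> real \<Rightarrow> real \<Rightarrow> ennreal" where
  "var_1d \<rho> h s t =
     (SUP (n, p) \<in> subdivisions s t.
        ennreal ((\<Sum>i<n. \<bar>h (p (Suc i)) - h (p i)\<bar> powr \<rho>) powr (1 / \<rho>)))"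

definition C_var :: "real \<Rightarrow> (real \<Rightarrow> real) set" where
  "C_var \<rho> = {h. continuous_on {0..1} h \<and> var_1d \<rho> h 0 1 < \<infinity>}"

definition rect_incr ::
  "(real \<Rightarrow> real \<Rightarrow> real) \<Rightarrow> real \<Rightarrow> real \<Rightarrow> real \<Rightarrow> real \<Rightarrow> real" where
  "rect_incr f s t u v = f s u + f t v - f s v - f t u"

definition var_2d ::
  "real \<Rightarrow> (real \<Rightarrow> real \<Rightarrow> real) \<Rightarrow> real \<Rightarrow> real \<Rightarrow> real \<Rightarrow> real \<Rightarrow> ennreal" where
  "var_2d \<rho> f s t u v =
     (SUP (n, p) \<in> subdivisions s t. SUP (m, q) \<in> subdivisions u v.
        ennreal ((\<Sum>i<n. \<Sum>j<m.
          \<bar>rect_incr f (p i) (p (Suc i)) (q j) (q (Suc j))\<bar> powr \<rho>) powr (1 / \<rho>)))"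

definition finite_var_2d :: "real \<Rightarrow> (real \<Rightarrow> real \<Rightarrow> real) \<Rightarrow> bool" where
  "finite_var_2d \<rho> f \<longleftrightarrow> var_2d \<rho> f 0 1 0 1 < \<infinity>"

end

theory Submission imports Defs begin

text \<open>For \<open>h = E(Z X)\<close> and a subdivision \<open>p\<close>, any combination \<open>\<Sum>i. \<beta> i * (h (p (Suc i)) - h (p i))\<close>
  is the \<open>L\<^sup>2\<close> inner product of \<open>Z\<close> with \<open>\<Sum>i. \<beta> i * (X (p (Suc i)) - X (p i))\<close>, whose second moment
  is the quadratic form in \<open>\<beta>\<close> of the rectangular increments of the covariance. By duality in
  \<open>\<ell>\<^sup>\<rho>\<close>, Cauchy-Schwarz and Hoelder this bounds the \<open>\<rho>\<close>-variation of \<open>h\<close>. Continuity of \<open>h\<close> needs \<open>X\<close>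
  to be continuous in \<open>L\<^sup>2\<close>, which is read off from \<open>E(cos Y) = exp (- E(Y\<^sup>2) / 2)\<close> for a centered
  Gaussian \<open>Y\<close>: pathwise continuity and dominated convergence control the left-hand side.\<close>

section \<open>Square-integrable functions\<close>

text \<open>Measurability is demanded separately, since squaring loses the sign:
  \<open>f\<^sup>2\<close> can be integrable without \<open>f\<close> being measurable.\<close>

definition square_integrable :: "'a measure \<Rightarrow> ('a \<Rightarrow> real) \<Rightarrow> bool" where
  "square_integrable M f \<longleftrightarrow> f \<in> borel_measurable M \<and> integrable M (\<lambda>x. (f x)\<^sup>2)"

lemma square_integrable_mult:
  assumes "square_integrable M f" "square_integrable M g"
  shows "integrable M (\<lambda>x. f x * g x)"
proof (rule Bochner_Integration.integrable_bound)
  show "integrable M (\<lambda>x. (f x)\<^sup>2 + (g x)\<^sup>2)"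
    using assms by (auto simp: square_integrable_def)
  show "(\<lambda>x. f x * g x) \<in> borel_measurable M"
    using assms by (auto simp: square_integrable_def)
  have "\<bar>a * b\<bar> \<le> a\<^sup>2 + b\<^sup>2" for a b :: real
  proof -
    have "2 * \<bar>a\<bar> * \<bar>b\<bar> \<le> a\<^sup>2 + b\<^sup>2"
      using sum_squares_bound[of "\<bar>a\<bar>" "\<bar>b\<bar>"] by simp
    moreover have "0 \<le> \<bar>a\<bar> * \<bar>b\<bar>"
      by simp
    ultimately show ?thesis
      unfolding abs_mult by linarith
  qed
  then show "AE x in M. norm (f x * g x) \<le> norm ((f x)\<^sup>2 + (g x)\<^sup>2)"
    by (auto simp: abs_mult)
qed

lemma square_integrable_scale:
  assumes "square_integrable M f"
  shows "square_integrable M (\<lambda>x. c * f x)"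
  using assms by (auto simp: square_integrable_def power_mult_distrib)

lemma square_integrable_add:
  assumes "square_integrable M f" "square_integrable M g"
  shows "square_integrable M (\<lambda>x. f x + g x)"
  using assms square_integrable_mult[OF assms]
  by (auto simp: square_integrable_def power2_sum mult.assoc)

lemma square_integrable_diff:
  assumes "square_integrable M f" "square_integrable M g"
  shows "square_integrable M (\<lambda>x. f x - g x)"
  using square_integrable_add[OF assms(1) square_integrable_scale[OF assms(2), of "-1"]] by simp

lemma square_integrable_sum:
  assumes "\<And>i. i \<in> I \<Longrightarrow> square_integrable M (f i)"
  shows "square_integrable M (\<lambda>x. \<Sum>i\<in>I. f i x)"
  using assms
proof (induction I rule: infinite_finite_induct)
  case (insert i I)
  then show ?case
    using square_integrable_add[of M "f i" "\<lambda>x. \<Sum>i\<in>I. f i x"] by auto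
qed (auto simp: square_integrable_def)

text \<open>The integral of \<open>(f + z * g)\<^sup>2\<close> is a nonnegative quadratic polynomial
  in \<open>z\<close>; evaluating it at its minimiser gives the inequality, unless the leading
  coefficient \<open>C\<close> vanishes.\<close>

lemma integral_Cauchy_Schwarz:
  assumes f: "square_integrable M f" and g: "square_integrable M g"
  shows "(\<integral>x. f x * g x \<partial>M)\<^sup>2 \<le> (\<integral>x. (f x)\<^sup>2 \<partial>M) * (\<integral>x. (g x)\<^sup>2 \<partial>M)"
proof -
  define A B C where "A = (\<integral>x. (f x)\<^sup>2 \<partial>M)" and "B = (\<integral>x. f x * g x \<partial>M)"
    and "C = (\<integral>x. (g x)\<^sup>2 \<partial>M)"
  have quad: "0 \<le> A + 2 * z * B + z\<^sup>2 * C" for z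
  proof -
    have [simp]: "integrable M (\<lambda>x. (f x)\<^sup>2)" "integrable M (\<lambda>x. (g x)\<^sup>2)"
      "integrable M (\<lambda>x. f x * g x)"
      using f g square_integrable_mult[OF f g] by (auto simp: square_integrable_def)
    have "0 \<le> (\<integral>x. (f x + z * g x)\<^sup>2 \<partial>M)"
      by simp
    also have "(\<lambda>x. (f x + z * g x)\<^sup>2) = (\<lambda>x. (f x)\<^sup>2 + 2 * z * (f x * g x) + z\<^sup>2 * (g x)\<^sup>2)"
      by (auto simp: power2_eq_square algebra_simps)
    also have "(\<integral>x. (f x)\<^sup>2 + 2 * z * (f x * g x) + z\<^sup>2 * (g x)\<^sup>2 \<partial>M) = A + 2 * z * B + z\<^sup>2 * C"
      by (simp add: A_def B_def C_def)
    finally show ?thesis .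
  qed
  have "0 \<le> C"
    by (simp add: C_def)
  have "B\<^sup>2 \<le> A * C"
  proof (cases "C = 0")
    case True
    have "B = 0"
    proof (rule ccontr)
      assume "B \<noteq> 0"
      \<comment> \<open>With \<open>C = 0\<close> the polynomial is affine in \<open>z\<close>, and
        this \<open>z\<close> is chosen to give it the value \<open>-1\<close>.\<close>
      then show False
        using quad[of "- (A + 1) / (2 * B)"] True by (simp add: field_simps)
    qed
    then show ?thesis
      by (simp add: True)
  next
    case False
    then have "0 < C"
      using \<open>0 \<le> C\<close> by simp
    \<comment> \<open>For \<open>C > 0\<close> the minimiser is \<open>z = - B / C\<close>.\<close>
    then have "A + 2 * (- B / C) * B + (- B / C)\<^sup>2 * C = (A * C - B\<^sup>2) / C"
      by (simp add: field_simps power2_eq_square)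
    with quad[of "- B / C"] \<open>0 < C\<close> show ?thesis
      by (simp add: zero_le_divide_iff)
  qed
  then show ?thesis
    by (simp add: A_def B_def C_def)
qed

section \<open>Gaussian variables\<close>

lemma (in prob_space) gaussian_square_integrable:
  assumes "gaussian M Y"
  shows "square_integrable M Y"
proof -
  have Y: "Y \<in> borel_measurable M"
    using assms by (simp add: gaussian_def)
  consider \<mu> \<sigma> where "0 < \<sigma>" "distributed M lborel Y (normal_density \<mu> \<sigma>)"
    | \<mu> where "AE \<omega> in M. Y \<omega> = \<mu>"
    using assms by (auto simp: gaussian_def)
  then have "integrable M (\<lambda>\<omega>. (Y \<omega>)\<^sup>2)"
  proof cases
    case 1
    \<comment> \<open>The decomposition \<open>x\<^sup>2 = (x - \<mu>)\<^sup>2 + 2 * \<mu> * x -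
      \<mu>\<^sup>2\<close> reduces the raw second moment to the central one and the mean.\<close>
    have "integrable lborel (\<lambda>x. normal_density \<mu> \<sigma> x * (x - \<mu>)\<^sup>2
        + 2 * \<mu> * (normal_density \<mu> \<sigma> x * x) - \<mu>\<^sup>2 * normal_density \<mu> \<sigma> x)"
      using integrable_normal_moment[OF 1(1), of \<mu> 2] integrable_normal_moment_nz_1[OF 1(1), of \<mu>]
        integrable_normal_density[OF 1(1), of \<mu>]
      by auto
    moreover have "(\<lambda>x. normal_density \<mu> \<sigma> x * (x - \<mu>)\<^sup>2
        + 2 * \<mu> * (normal_density \<mu> \<sigma> x * x) - \<mu>\<^sup>2 * normal_density \<mu> \<sigma> x)
      = (\<lambda>x. normal_density \<mu> \<sigma> x * x\<^sup>2)"
      by (auto simp: power2_eq_square algebra_simps)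
    ultimately show ?thesis
      using distributed_integrable[OF 1(2), of "\<lambda>x. x\<^sup>2"] by auto
  next
    case 2
    then have "AE \<omega> in M. (Y \<omega>)\<^sup>2 = \<mu>\<^sup>2"
      by auto
    then show ?thesis
      using Y by (subst integrable_cong_AE[where g = "\<lambda>_. \<mu>\<^sup>2"]) auto
  qed
  with Y show ?thesis
    by (simp add: square_integrable_def)
qed

text \<open>In the nondegenerate case this is the real part of the characteristic function of
  \<open>Y / \<sigma>\<close>, a standard normal variable, at the point \<open>\<sigma>\<close>; as
  the mean is zero, \<open>\<sigma>\<^sup>2\<close> is the second moment. In the degenerate case
  \<open>Y\<close> vanishes almost surely and both sides equal 1.\<close>

lemma (in prob_space) centered_gaussian_expectation_cos:
  assumes "gaussian M Y" and "expectation Y = 0"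
  shows "expectation (\<lambda>\<omega>. cos (Y \<omega>)) = exp (- expectation (\<lambda>\<omega>. (Y \<omega>)\<^sup>2) / 2)"
proof -
  have Y[measurable]: "Y \<in> borel_measurable M"
    using assms by (simp add: gaussian_def)
  consider \<mu> \<sigma> where "0 < \<sigma>" "distributed M lborel Y (normal_density \<mu> \<sigma>)"
    | \<mu> where "AE \<omega> in M. Y \<omega> = \<mu>"
    using assms by (auto simp: gaussian_def)
  then show ?thesis
  proof cases
    case 1
    have "\<mu> = 0"
      using normal_distributed_expectation[OF 1] assms by simp
    then have D: "distributed M lborel (\<lambda>\<omega>. Y \<omega> / \<sigma>) std_normal_density"
      using 1 normal_standard_normal_convert[OF 1(1), of Y 0] by simp
    have "complex_of_real (exp (- \<sigma>\<^sup>2 / 2)) = (CLINT x | std_normal_distribution. iexp (\<sigma> * x))"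
      using fun_cong[OF char_std_normal_distribution, of \<sigma>] by (simp add: char_def)
    also have "std_normal_distribution = distr M borel (\<lambda>\<omega>. Y \<omega> / \<sigma>)"
      using distributed_distr_eq_density[OF D] by (simp cong: distr_cong)
    also have "(CLINT x | distr M borel (\<lambda>\<omega>. Y \<omega> / \<sigma>). iexp (\<sigma> * x)) = (CLINT \<omega> | M. iexp (Y \<omega>))"
      using 1(1) by (subst integral_distr) auto
    finally have "Re (complex_of_real (exp (- \<sigma>\<^sup>2 / 2))) = Re (CLINT \<omega> | M. iexp (Y \<omega>))"
      by simp
    also have "\<dots> = expectation (\<lambda>\<omega>. Re (iexp (Y \<omega>)))"
      by (rule integral_Re[symmetric]) (auto intro!: integrable_const_bound[where B = 1])
    finally show ?thesis
      using normal_distributed_variance[OF 1] assms by (simp add: Re_exp)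
  next
    case 2
    have "expectation Y = \<mu>"
      using integral_cong_AE[of Y M "\<lambda>_. \<mu>"] 2 by (simp add: prob_space)
    then have "AE \<omega> in M. Y \<omega> = 0"
      using 2 assms by simp
    then have "AE \<omega> in M. cos (Y \<omega>) = 1" "AE \<omega> in M. (Y \<omega>)\<^sup>2 = 0"
      by auto
    then have "expectation (\<lambda>\<omega>. cos (Y \<omega>)) = expectation (\<lambda>_. 1)"
      "expectation (\<lambda>\<omega>. (Y \<omega>)\<^sup>2) = expectation (\<lambda>_. 0)"
      using integral_cong_AE[of "\<lambda>\<omega>. cos (Y \<omega>)" M "\<lambda>_. 1"]
        integral_cong_AE[of "\<lambda>\<omega>. (Y \<omega>)\<^sup>2" M "\<lambda>_. 0"] by simp_all
    then show ?thesis
      by (simp add: prob_space)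
  qed
qed

text \<open>Pointwise convergence alone would not give convergence in mean square. Gaussianity
  encodes the second moment in the expectation of the bounded function \<open>cos\<close>, where the
  constant 1 dominates; a logarithm, continuous at 1, then recovers the second moment.\<close>

lemma (in prob_space) centered_gaussian_second_moment_LIMSEQ:
  assumes gauss: "\<And>n. gaussian M (Y n)" and mean: "\<And>n. expectation (Y n) = 0"
    and lim: "\<And>\<omega>. \<omega> \<in> space M \<Longrightarrow> (\<lambda>n. Y n \<omega>) \<longlonglongrightarrow> 0"
  shows "(\<lambda>n. expectation (\<lambda>\<omega>. (Y n \<omega>)\<^sup>2)) \<longlonglongrightarrow> 0"
proof -
  have [measurable]: "Y n \<in> borel_measurable M" for n
    using gauss[of n] by (simp add: gaussian_def)
  have "(\<lambda>n. expectation (\<lambda>\<omega>. cos (Y n \<omega>))) \<longlonglongrightarrow> expectation (\<lambda>_. cos 0)"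
  proof (rule integral_dominated_convergence[where w = "\<lambda>_. 1"])
    show "AE \<omega> in M. (\<lambda>n. cos (Y n \<omega>)) \<longlonglongrightarrow> cos 0"
      by (intro AE_I2 tendsto_cos lim)
  qed auto
  then have "(\<lambda>n. exp (- expectation (\<lambda>\<omega>. (Y n \<omega>)\<^sup>2) / 2)) \<longlonglongrightarrow> 1"
    by (simp add: centered_gaussian_expectation_cos[OF gauss mean] prob_space)
  then have "(\<lambda>n. - 2 * ln (exp (- expectation (\<lambda>\<omega>. (Y n \<omega>)\<^sup>2) / 2))) \<longlonglongrightarrow> - 2 * ln 1"
    by (intro tendsto_intros) auto
  then show ?thesis
    by simp
qed

section \<open>The duality estimate\<close>

text \<open>Weights in place of conjugate exponents include the endpoint \<open>\<rho> = 1\<close>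
  as \<open>\<alpha> = 0\<close>, with no infinite exponent. Once both sums are normalised to 1, the
  weighted Young inequality applies term by term.\<close>

lemma Hoelder_inequality_sum:
  fixes a b :: "'i \<Rightarrow> real"
  assumes "0 \<le> \<alpha>" "0 \<le> \<beta>" "\<alpha> + \<beta> = 1" and "finite I"
    and a: "\<And>i. i \<in> I \<Longrightarrow> 0 \<le> a i" and b: "\<And>i. i \<in> I \<Longrightarrow> 0 \<le> b i"
  shows "(\<Sum>i\<in>I. a i powr \<alpha> * b i powr \<beta>) \<le> sum a I powr \<alpha> * sum b I powr \<beta>"
proof (cases "sum a I = 0 \<or> sum b I = 0")
  case True
  then have "(\<forall>i\<in>I. a i = 0) \<or> (\<forall>i\<in>I. b i = 0)"
    using assms sum_nonneg_eq_0_iff by blast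
  then show ?thesis
    by (auto intro!: sum_nonpos)
next
  case False
  define A B where "A = sum a I" and "B = sum b I"
  have "0 \<le> A" "0 \<le> B"
    using a b by (auto simp: A_def B_def intro!: sum_nonneg)
  with False have "0 < A" "0 < B"
    by (auto simp: A_def B_def)
  have young: "x powr \<alpha> * y powr \<beta> \<le> \<alpha> * x + \<beta> * y" if "0 \<le> x" "0 \<le> y" for x y
  \<comment> \<open>Since \<open>0 powr 0 = 0\<close>, the left side vanishes in the first case even
    when a weight is zero.\<close>
  proof (cases "x = 0 \<or> y = 0")
    case True
    then show ?thesis
      using that assms by auto
  next
    case False
    then show ?thesis
      using that assms Youngs_inequality_0[of \<alpha> \<beta> x y] by auto
  qed
  have "(\<Sum>i\<in>I. a i powr \<alpha> * b i powr \<beta>) / (A powr \<alpha> * B powr \<beta>)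
      = (\<Sum>i\<in>I. (a i / A) powr \<alpha> * (b i / B) powr \<beta>)"
    using a b \<open>0 < A\<close> \<open>0 < B\<close> by (auto simp: sum_divide_distrib powr_divide intro!: sum.cong)
  also have "\<dots> \<le> (\<Sum>i\<in>I. \<alpha> * (a i / A) + \<beta> * (b i / B))"
    using a b \<open>0 < A\<close> \<open>0 < B\<close> by (intro sum_mono young) auto
  also have "\<dots> = \<alpha> * (A / A) + \<beta> * (B / B)"
    unfolding sum.distrib sum_distrib_left[symmetric] sum_divide_distrib[symmetric]
    by (simp add: A_def B_def)
  also have "\<dots> = 1"
    using \<open>0 < A\<close> \<open>0 < B\<close> assms by simp
  finally show ?thesis
    using \<open>0 < A\<close> \<open>0 < B\<close> by (simp add: A_def B_def field_simps)
qed

text \<open>The test vector \<open>\<beta> i = sgn (d i) * \<bar>d i\<bar> powr (\<rho> - 1)\<close> norms \<open>d\<close> in \<open>\<ell>\<^sup>\<rho>\<close>;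
  Hoelder's inequality with weights \<open>(\<rho> - 1) / \<rho>\<close> and \<open>1 / \<rho>\<close> on pairs of indices then bounds the
  quadratic form, and the resulting power of \<open>\<Sum>i. \<bar>d i\<bar> powr \<rho>\<close> is cancelled.\<close>

lemma powr_sum_le_of_quadratic_bound:
  fixes d :: "'i \<Rightarrow> real" and r :: "'i \<Rightarrow> 'i \<Rightarrow> real"
  assumes "1 \<le> \<rho>" "finite I" "0 \<le> c"
    and bound: "\<And>\<beta>. (\<Sum>i\<in>I. \<beta> i * d i)\<^sup>2 \<le> c * (\<Sum>i\<in>I. \<Sum>j\<in>I. \<beta> i * \<beta> j * r i j)"
  shows "(\<Sum>i\<in>I. \<bar>d i\<bar> powr \<rho>) powr (1 / \<rho>)
    \<le> sqrt c * sqrt ((\<Sum>i\<in>I. \<Sum>j\<in>I. \<bar>r i j\<bar> powr \<rho>) powr (1 / \<rho>))"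
proof -
  define S V \<alpha> where "S = (\<Sum>i\<in>I. \<bar>d i\<bar> powr \<rho>)"
    and "V = (\<Sum>i\<in>I. \<Sum>j\<in>I. \<bar>r i j\<bar> powr \<rho>) powr (1 / \<rho>)" and "\<alpha> = (\<rho> - 1) / \<rho>"
  define \<beta> where "\<beta> i = sgn (d i) * \<bar>d i\<bar> powr (\<rho> - 1)" for i
  have \<alpha>: "0 \<le> \<alpha>" "\<alpha> + 1 / \<rho> = 1" "\<rho> * \<alpha> = \<rho> - 1"
    using \<open>1 \<le> \<rho>\<close> by (auto simp: \<alpha>_def field_simps)
  have "\<beta> i * d i = \<bar>d i\<bar> powr \<rho>" for i
  proof (cases "d i = 0")
    case False
    then have "\<beta> i * d i = \<bar>d i\<bar> powr 1 * \<bar>d i\<bar> powr (\<rho> - 1)"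
      by (simp add: \<beta>_def sgn_if)
    also have "\<dots> = \<bar>d i\<bar> powr \<rho>"
      by (subst powr_add[symmetric]) simp
    finally show ?thesis .
  qed (simp add: \<beta>_def)
  then have "S\<^sup>2 \<le> c * (\<Sum>i\<in>I. \<Sum>j\<in>I. \<beta> i * \<beta> j * r i j)"
    using bound[of \<beta>] by (simp add: S_def)
  also have "(\<Sum>i\<in>I. \<Sum>j\<in>I. \<beta> i * \<beta> j * r i j) \<le>
     (\<Sum>(i, j)\<in>I \<times> I. (\<bar>d i\<bar> powr \<rho> * \<bar>d j\<bar> powr \<rho>) powr \<alpha> * (\<bar>r i j\<bar> powr \<rho>) powr (1 / \<rho>))"
    unfolding sum.cartesian_product[symmetric]
  proof (intro sum_mono)
    fix i j
    have \<beta>: "\<bar>\<beta> k\<bar> \<le> \<bar>d k\<bar> powr (\<rho> - 1)" for k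
      by (auto simp: \<beta>_def abs_mult abs_sgn_eq)
    have "\<beta> i * \<beta> j * r i j \<le> \<bar>\<beta> i\<bar> * \<bar>\<beta> j\<bar> * \<bar>r i j\<bar>"
      by (simp flip: abs_mult)
    also have "\<dots> \<le> \<bar>d i\<bar> powr (\<rho> - 1) * \<bar>d j\<bar> powr (\<rho> - 1) * \<bar>r i j\<bar>"
      by (intro mult_mono \<beta> mult_nonneg_nonneg abs_ge_zero powr_ge_zero order_refl)
    also have "\<dots> = (\<bar>d i\<bar> powr \<rho> * \<bar>d j\<bar> powr \<rho>) powr \<alpha> * (\<bar>r i j\<bar> powr \<rho>) powr (1 / \<rho>)"
      using \<open>1 \<le> \<rho>\<close> by (simp add: powr_mult powr_powr \<alpha>)
    finally show "\<beta> i * \<beta> j * r i j \<le> \<dots>" .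
  qed
  also have "\<dots> \<le> (S * S) powr \<alpha> * V"
    using Hoelder_inequality_sum[of \<alpha> "1 / \<rho>" "I \<times> I" "\<lambda>(i, j). \<bar>d i\<bar> powr \<rho> * \<bar>d j\<bar> powr \<rho>"
        "\<lambda>(i, j). \<bar>r i j\<bar> powr \<rho>"] \<alpha> assms
    by (simp add: S_def V_def split_beta' sum_product sum.cartesian_product)
  finally have sq: "S\<^sup>2 \<le> c * ((S * S) powr \<alpha> * V)"
    using \<open>0 \<le> c\<close> by (simp add: mult_left_mono)
  have "0 \<le> S" "0 \<le> V"
    by (auto simp: S_def V_def intro!: sum_nonneg)
  show ?thesis
  proof (cases "S = 0")
    case True
    then show ?thesis
      using \<open>0 \<le> c\<close> by (simp flip: S_def V_def add: \<open>0 \<le> V\<close>)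
  next
    case False
    then have "0 < S"
      using \<open>0 \<le> S\<close> by simp
    \<comment> \<open>Splitting \<open>S\<^sup>2\<close> this way exposes the factor
      \<open>(S powr \<alpha>)\<^sup>2\<close> of the upper bound; it is positive because
      \<open>S > 0\<close>, and what remains is the square of the desired norm.\<close>
    have "S powr \<alpha> * S powr (1 / \<rho>) = S"
      using \<open>0 < S\<close> \<alpha> by (simp flip: powr_add)
    then have "(S powr \<alpha>)\<^sup>2 * (S powr (1 / \<rho>))\<^sup>2 = S\<^sup>2"
      by (simp flip: power_mult_distrib)
    also have "\<dots> \<le> (S powr \<alpha>)\<^sup>2 * (c * V)"
      using sq \<open>0 < S\<close> by (simp add: powr_mult power2_eq_square mult_ac)
    finally have "(S powr (1 / \<rho>))\<^sup>2 \<le> c * V"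
      using \<open>0 < S\<close> by simp
    then have "S powr (1 / \<rho>) \<le> sqrt (c * V)"
      by (rule real_le_rsqrt)
    then show ?thesis
      by (simp add: S_def V_def real_sqrt_mult)
  qed
qed

section \<open>Subdivisions\<close>

lemma subdivisions_mono:
  assumes "(n, p) \<in> subdivisions s t" "i \<le> j" "j \<le> n"
  shows "p i \<le> p j"
  using assms(2,3)
proof (induction j rule: dec_induct)
  case (step j)
  then have "p j < p (Suc j)"
    using assms(1) by (auto simp: subdivisions_def)
  with step show ?case
    by simp
qed simp

lemma subdivisions_mem:
  assumes "(n, p) \<in> subdivisions s t" "i \<le> n"
  shows "p i \<in> {s..t}"
  using subdivisions_mono[OF assms(1), of 0 i] subdivisions_mono[OF assms(1), of i n] assms
  by (auto simp: subdivisions_def)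

text \<open>Points of a subdivision are strictly increasing, so \<open>a\<close> is prepended only
  if it differs from \<open>s\<close>, and \<open>b\<close> appended only if it differs from
  \<open>t\<close>. The old points thus form a contiguous block, at offset \<open>k = 0\<close> or
  \<open>k = 1\<close>.\<close>

lemma subdivision_extend:
  assumes p: "(n, p) \<in> subdivisions s t" and "a \<le> s" "t \<le> b"
  obtains n' p' k where "(n', p') \<in> subdivisions a b" "k + n \<le> n'" "\<And>i. i \<le> n \<Longrightarrow> p' (k + i) = p i"
proof -
  obtain n1 p1 k where 1: "(n1, p1) \<in> subdivisions a t" "k + n = n1"
    "\<And>i. i \<le> n \<Longrightarrow> p1 (k + i) = p i"
  proof (cases "a = s")
    case True
    then show ?thesis
      using that[of n p 0] p by auto
  next
    case False
    then have "(Suc n, case_nat a p) \<in> subdivisions a t"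
      using p \<open>a \<le> s\<close> by (auto simp: subdivisions_def split: nat.splits)
    then show ?thesis
      using that[of "Suc n" "case_nat a p" 1] by auto
  qed
  show ?thesis
  proof (cases "t = b")
    case True
    then show ?thesis
      using that[of n1 p1 k] 1 by auto
  next
    case False
    then have "(Suc n1, p1(Suc n1 := b)) \<in> subdivisions a b"
      using 1(1) \<open>t \<le> b\<close> by (auto simp: subdivisions_def less_Suc_eq)
    then show ?thesis
      using that[of "Suc n1" "p1(Suc n1 := b)" k] 1 by auto
  qed
qed

lemma var_2d_upper:
  assumes "(n, p) \<in> subdivisions s t" "(m, q) \<in> subdivisions u v"
  shows "ennreal ((\<Sum>i<n. \<Sum>j<m.
    \<bar>rect_incr f (p i) (p (Suc i)) (q j) (q (Suc j))\<bar> powr \<rho>) powr (1 / \<rho>)) \<le> var_2d \<rho> f s t u v"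
  unfolding var_2d_def using assms by (intro SUP_upper2[OF assms(1)]) (auto intro: SUP_upper2[OF assms(2)])

text \<open>Extending both subdivisions keeps every old cell and only adds cells with nonnegative
  contributions. This transfers finiteness from the unit square to every smaller square.\<close>

lemma var_2d_mono:
  assumes "1 \<le> \<rho>" "a \<le> s" "t \<le> b" "a' \<le> u" "v \<le> b'"
  shows "var_2d \<rho> f s t u v \<le> var_2d \<rho> f a b a' b'"
  unfolding var_2d_def[of \<rho> f s t u v]
proof (intro SUP_least, clarify, intro SUP_least, clarify)
  fix n p m q
  assume p: "(n, p) \<in> subdivisions s t" and q: "(m, q) \<in> subdivisions u v"
  obtain n' p' k where p': "(n', p') \<in> subdivisions a b" "k + n \<le> n'"
    "\<And>i. i \<le> n \<Longrightarrow> p' (k + i) = p i"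
    using subdivision_extend[OF p \<open>a \<le> s\<close> \<open>t \<le> b\<close>] by metis
  obtain m' q' l where q': "(m', q') \<in> subdivisions a' b'" "l + m \<le> m'"
    "\<And>i. i \<le> m \<Longrightarrow> q' (l + i) = q i"
    using subdivision_extend[OF q \<open>a' \<le> u\<close> \<open>v \<le> b'\<close>] by metis
  define g g' where "g i j = \<bar>rect_incr f (p i) (p (Suc i)) (q j) (q (Suc j))\<bar> powr \<rho>"
    and "g' i j = \<bar>rect_incr f (p' i) (p' (Suc i)) (q' j) (q' (Suc j))\<bar> powr \<rho>" for i j
  have "g i j = g' (k + i) (l + j)" if "i < n" "j < m" for i j
    using p'(3)[of i] p'(3)[of "Suc i"] q'(3)[of j] q'(3)[of "Suc j"] that
    by (simp add: g_def g'_def)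
  then have "(\<Sum>i<n. \<Sum>j<m. g i j) = (\<Sum>i<n. \<Sum>j<m. g' (k + i) (l + j))"
    by simp
  \<comment> \<open>The old cells become a translated index rectangle inside the index set of the
    larger grid.\<close>
  also have "\<dots> = (\<Sum>(i, j)\<in>(+) k ` {..<n} \<times> (+) l ` {..<m}. g' i j)"
    by (simp add: sum.reindex flip: sum.cartesian_product)
  also have "\<dots> \<le> (\<Sum>(i, j)\<in>{..<n'} \<times> {..<m'}. g' i j)"
    using p'(2) q'(2) by (intro sum_mono2) (auto simp: g'_def)
  finally have "(\<Sum>i<n. \<Sum>j<m. g i j) \<le> (\<Sum>i<n'. \<Sum>j<m'. g' i j)"
    by (simp add: sum.cartesian_product)
  then have "(\<Sum>i<n. \<Sum>j<m. g i j) powr (1 / \<rho>) \<le> (\<Sum>i<n'. \<Sum>j<m'. g' i j) powr (1 / \<rho>)"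
    using \<open>1 \<le> \<rho>\<close> by (intro powr_mono2) (auto simp: g_def intro!: sum_nonneg)
  then have "ennreal ((\<Sum>i<n. \<Sum>j<m. g i j) powr (1 / \<rho>))
      \<le> ennreal ((\<Sum>i<n'. \<Sum>j<m'. g' i j) powr (1 / \<rho>))"
    by (rule ennreal_leI)
  also have "\<dots> \<le> var_2d \<rho> f a b a' b'"
    unfolding g'_def by (rule var_2d_upper[OF p'(1) q'(1)])
  finally show "ennreal ((\<Sum>i<n. \<Sum>j<m.
      \<bar>rect_incr f (p i) (p (Suc i)) (q j) (q (Suc j))\<bar> powr \<rho>) powr (1 / \<rho>)) \<le> var_2d \<rho> f a b a' b'"
    by (simp add: g_def)
qed

section \<open>The Cameron-Martin space\<close>

lemma linear_span_member: "t \<in> {0..1} \<Longrightarrow> X t \<in> linear_span X"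
  unfolding linear_span_def by (auto intro!: exI[of _ "{t}"] exI[of _ "\<lambda>_. 1"])

lemma linear_span_diff_member:
  assumes "s \<in> {0..1}" "t \<in> {0..1}"
  shows "(\<lambda>\<omega>. X s \<omega> - X t \<omega>) \<in> linear_span X"
\<comment> \<open>For \<open>s = t\<close> the coefficients \<open>1\<close> and \<open>-1\<close>
  would have to sit on the same index; the empty combination represents zero instead.\<close>
proof (cases "s = t")
  case True
  then show ?thesis
    unfolding linear_span_def by (auto intro!: exI[of _ "{}"])
next
  case False
  then show ?thesis
    unfolding linear_span_def using assms
    by (auto intro!: exI[of _ "{s, t}"] exI[of _ "\<lambda>u. if u = s then 1 else -1"])
qed

lemma (in prob_space) gaussian_process_square_integrable:
  assumes "gaussian_process M X" "t \<in> {0..1}"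
  shows "square_integrable M (X t)"
  using assms linear_span_member[of t X] gaussian_square_integrable
  by (auto simp: gaussian_process_def)

lemma closed_linear_span_square_integrable:
  "Z \<in> closed_linear_span M X \<Longrightarrow> square_integrable M Z"
  by (simp add: closed_linear_span_def square_integrable_def)

text \<open>Orthogonality passes to finite combinations by linearity and to \<open>L\<^sup>2\<close>
  limits by Cauchy-Schwarz. It is applied with \<open>D\<close> the difference of two
  representatives of one path.\<close>

lemma (in prob_space) orthogonal_closed_linear_span:
  assumes X: "gaussian_process M X" and D: "square_integrable M D"
    and orth: "\<And>t. t \<in> {0..1} \<Longrightarrow> expectation (\<lambda>\<omega>. D \<omega> * X t \<omega>) = 0"
    and W: "W \<in> closed_linear_span M X"
  shows "expectation (\<lambda>\<omega>. D \<omega> * W \<omega>) = 0"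
proof -
  define A where "A = expectation (\<lambda>\<omega>. (D \<omega>)\<^sup>2)"
  have "0 \<le> A"
    by (simp add: A_def)
  have W2: "square_integrable M W"
    by (rule closed_linear_span_square_integrable[OF W])
  have "(expectation (\<lambda>\<omega>. D \<omega> * W \<omega>))\<^sup>2 \<le> 0"
  proof (rule field_le_epsilon)
    fix e :: real assume "0 < e"
    \<comment> \<open>The denominator is \<open>A + 1\<close> because \<open>A\<close> may be zero;
      \<open>A * (e / (A + 1)) \<le> e\<close> holds in any case.\<close>
    then obtain Y where Y: "Y \<in> linear_span X" "expectation (\<lambda>\<omega>. (W \<omega> - Y \<omega>)\<^sup>2) < e / (A + 1)"
      using W \<open>0 \<le> A\<close> by (auto simp: closed_linear_span_def dest!: spec[of _ "e / (A + 1)"])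
    then obtain T c where T: "finite T" "T \<subseteq> {0..1}" "Y = (\<lambda>\<omega>. \<Sum>t\<in>T. c t * X t \<omega>)"
      by (auto simp: linear_span_def)
    have Y2: "square_integrable M Y"
      using X Y(1) gaussian_square_integrable by (auto simp: gaussian_process_def)
    have int: "integrable M (\<lambda>\<omega>. D \<omega> * X t \<omega>)" if "t \<in> T" for t
      using square_integrable_mult[OF D gaussian_process_square_integrable[OF X]] T that by auto
    have "expectation (\<lambda>\<omega>. D \<omega> * Y \<omega>) = expectation (\<lambda>\<omega>. \<Sum>t\<in>T. c t * (D \<omega> * X t \<omega>))"
      by (simp add: T sum_distrib_left mult_ac)
    also have "\<dots> = (\<Sum>t\<in>T. c t * expectation (\<lambda>\<omega>. D \<omega> * X t \<omega>))"
      using int by (subst Bochner_Integration.integral_sum) auto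
    also have "\<dots> = 0"
      using orth T by (intro sum.neutral) auto
    finally have "expectation (\<lambda>\<omega>. D \<omega> * W \<omega>) = expectation (\<lambda>\<omega>. D \<omega> * (W \<omega> - Y \<omega>))"
      using square_integrable_mult[OF D W2] square_integrable_mult[OF D Y2]
      by (simp add: right_diff_distrib)
    then have "(expectation (\<lambda>\<omega>. D \<omega> * W \<omega>))\<^sup>2 \<le> A * expectation (\<lambda>\<omega>. (W \<omega> - Y \<omega>)\<^sup>2)"
      using integral_Cauchy_Schwarz[OF D square_integrable_diff[OF W2 Y2]] by (simp add: A_def)
    also have "\<dots> \<le> A * (e / (A + 1))"
      using Y(2) \<open>0 \<le> A\<close> by (intro mult_left_mono) auto
    also have "\<dots> \<le> 0 + e"
      using \<open>0 \<le> A\<close> \<open>0 < e\<close> by (simp add: field_simps)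
    finally show "(expectation (\<lambda>\<omega>. D \<omega> * W \<omega>))\<^sup>2 \<le> 0 + e" .
  qed
  then show ?thesis
    by simp
qed

text \<open>The definite description in \<open>cm_inner\<close> is meaningful only if all pairs of
  representatives give the same value. Two representatives differ by a function orthogonal to every
  \<open>X t\<close>, hence to the closed span, so either may replace the other inside an inner
  product.\<close>

lemma (in prob_space) cm_inner_self:
  assumes X: "gaussian_process M X" and Z: "represents M X Z h"
  shows "cm_inner M X h h = expectation (\<lambda>\<omega>. (Z \<omega>)\<^sup>2)"
proof -
  have span: "W \<in> closed_linear_span M X" if "represents M X W h" for W
    using that by (simp add: represents_def)
  have swap: "expectation (\<lambda>\<omega>. U \<omega> * W \<omega>) = expectation (\<lambda>\<omega>. V \<omega> * W \<omega>)"
    if "represents M X U h" "represents M X V h" "represents M X W h" for U V W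
  proof -
    have sq: "square_integrable M U" "square_integrable M V" "square_integrable M W"
      using that by (auto intro: closed_linear_span_square_integrable span)
    have "expectation (\<lambda>\<omega>. (U \<omega> - V \<omega>) * W \<omega>) = 0"
    proof (rule orthogonal_closed_linear_span[OF X _ _ span])
      show "square_integrable M (\<lambda>\<omega>. U \<omega> - V \<omega>)"
        by (rule square_integrable_diff[OF sq(1,2)])
      show "expectation (\<lambda>\<omega>. (U \<omega> - V \<omega>) * X t \<omega>) = 0" if "t \<in> {0..1}" for t
        using square_integrable_mult[OF sq(1) gaussian_process_square_integrable[OF X that]]
          square_integrable_mult[OF sq(2) gaussian_process_square_integrable[OF X that]]
          \<open>represents M X U h\<close> \<open>represents M X V h\<close> that
        by (simp add: left_diff_distrib represents_def)
    qed fact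
    then show ?thesis
      using square_integrable_mult[OF sq(1,3)] square_integrable_mult[OF sq(2,3)]
      by (simp add: left_diff_distrib)
  qed
  have eq: "expectation (\<lambda>\<omega>. U \<omega> * V \<omega>) = expectation (\<lambda>\<omega>. (Z \<omega>)\<^sup>2)"
    if "represents M X U h" "represents M X V h" for U V
    \<comment> \<open>Two replacements, \<open>E(U V) = E(Z V)\<close> and
      \<open>E(V Z) = E(Z Z)\<close>.\<close>
    using swap[OF that(1) Z that(2)] swap[OF that(2) Z Z] by (simp add: mult.commute power2_eq_square)
  show ?thesis
    unfolding cm_inner_def
  proof (rule the_equality)
    show "\<exists>U V. represents M X U h \<and> represents M X V h \<and>
        expectation (\<lambda>\<omega>. (Z \<omega>)\<^sup>2) = expectation (\<lambda>\<omega>. U \<omega> * V \<omega>)"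
      using Z eq[OF Z Z] by metis
  qed (use eq in blast)
qed

text \<open>Cauchy-Schwarz for \<open>Z\<close> against
  \<open>\<Sum>i. \<beta> i * \<Delta> i\<close>; this provides the premise \<open>bound\<close> of
  the duality estimate, with \<open>c\<close> the second moment of \<open>Z\<close>.\<close>

lemma (in prob_space) represents_quadratic_bound:
  assumes X: "gaussian_process M X" and Z: "represents M X Z h"
    and p: "\<And>i. i \<le> n \<Longrightarrow> p i \<in> {0..1}"
  shows "(\<Sum>i<n. \<beta> i * (h (p (Suc i)) - h (p i)))\<^sup>2 \<le> expectation (\<lambda>\<omega>. (Z \<omega>)\<^sup>2) *
    (\<Sum>i<n. \<Sum>j<n. \<beta> i * \<beta> j * rect_incr (covariance M X) (p i) (p (Suc i)) (p j) (p (Suc j)))"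
proof -
  define \<Delta> where "\<Delta> i \<omega> = X (p (Suc i)) \<omega> - X (p i) \<omega>" for i \<omega>
  have Xp: "square_integrable M (X (p i))" if "i \<le> n" for i
    by (rule gaussian_process_square_integrable[OF X p[OF that]])
  have \<Delta>: "square_integrable M (\<Delta> i)" if "i < n" for i
    unfolding \<Delta>_def[abs_def] using that by (intro square_integrable_diff Xp) auto
  have Z2: "square_integrable M Z"
    using Z closed_linear_span_square_integrable by (auto simp: represents_def)
  have h: "h (p (Suc i)) - h (p i) = expectation (\<lambda>\<omega>. Z \<omega> * \<Delta> i \<omega>)" if "i < n" for i
    using Z p[of i] p[of "Suc i"] that square_integrable_mult[OF Z2 Xp[of i]]
      square_integrable_mult[OF Z2 Xp[of "Suc i"]]
    by (simp add: represents_def \<Delta>_def right_diff_distrib)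
  \<comment> \<open>By bilinearity, a rectangular increment of the covariance is the mixed second
    moment of two increments of \<open>X\<close>.\<close>
  have R: "rect_incr (covariance M X) (p i) (p (Suc i)) (p j) (p (Suc j))
      = expectation (\<lambda>\<omega>. \<Delta> i \<omega> * \<Delta> j \<omega>)" if "i < n" "j < n" for i j
  proof -
    have [simp]: "integrable M (\<lambda>\<omega>. X (p a) \<omega> * X (p b) \<omega>)" if "a \<le> n" "b \<le> n" for a b
      using square_integrable_mult[OF Xp Xp] that by auto
    have "expectation (\<lambda>\<omega>. \<Delta> i \<omega> * \<Delta> j \<omega>)
      = expectation (\<lambda>\<omega>. X (p i) \<omega> * X (p j) \<omega> + X (p (Suc i)) \<omega> * X (p (Suc j)) \<omega>
          - X (p i) \<omega> * X (p (Suc j)) \<omega> - X (p (Suc i)) \<omega> * X (p j) \<omega>)"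
      by (rule Bochner_Integration.integral_cong) (auto simp: \<Delta>_def algebra_simps)
    then show ?thesis
      using that by (simp add: rect_incr_def covariance_def)
  qed
  define Y where "Y = (\<lambda>\<omega>. \<Sum>i<n. \<beta> i * \<Delta> i \<omega>)"
  have Y2: "square_integrable M Y"
    unfolding Y_def using \<Delta> by (intro square_integrable_sum square_integrable_scale) auto
  have "(\<Sum>i<n. \<beta> i * (h (p (Suc i)) - h (p i))) = (\<Sum>i<n. \<beta> i * expectation (\<lambda>\<omega>. Z \<omega> * \<Delta> i \<omega>))"
    by (simp add: h)
  also have "\<dots> = expectation (\<lambda>\<omega>. \<Sum>i<n. \<beta> i * (Z \<omega> * \<Delta> i \<omega>))"
    using square_integrable_mult[OF Z2 \<Delta>] by (subst Bochner_Integration.integral_sum) auto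
  also have "\<dots> = expectation (\<lambda>\<omega>. Z \<omega> * Y \<omega>)"
    by (simp add: Y_def sum_distrib_left mult_ac)
  finally have 1: "(\<Sum>i<n. \<beta> i * (h (p (Suc i)) - h (p i))) = expectation (\<lambda>\<omega>. Z \<omega> * Y \<omega>)" .
  have "expectation (\<lambda>\<omega>. (Y \<omega>)\<^sup>2) = expectation (\<lambda>\<omega>. \<Sum>i<n. \<Sum>j<n. \<beta> i * \<beta> j * (\<Delta> i \<omega> * \<Delta> j \<omega>))"
    by (simp add: Y_def power2_eq_square sum_product mult_ac)
  also have "\<dots> = (\<Sum>i<n. \<Sum>j<n. \<beta> i * \<beta> j * expectation (\<lambda>\<omega>. \<Delta> i \<omega> * \<Delta> j \<omega>))"
  proof (subst Bochner_Integration.integral_sum)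
    show "integrable M (\<lambda>\<omega>. \<Sum>j<n. \<beta> i * \<beta> j * (\<Delta> i \<omega> * \<Delta> j \<omega>))" if "i \<in> {..<n}" for i
      using that by (intro Bochner_Integration.integrable_sum integrable_mult_right
          square_integrable_mult \<Delta>) auto
    show "(\<Sum>i<n. expectation (\<lambda>\<omega>. \<Sum>j<n. \<beta> i * \<beta> j * (\<Delta> i \<omega> * \<Delta> j \<omega>)))
        = (\<Sum>i<n. \<Sum>j<n. \<beta> i * \<beta> j * expectation (\<lambda>\<omega>. \<Delta> i \<omega> * \<Delta> j \<omega>))"
    proof (rule sum.cong[OF refl])
      fix i assume "i \<in> {..<n}"
      then have "integrable M (\<lambda>\<omega>. \<beta> i * \<beta> j * (\<Delta> i \<omega> * \<Delta> j \<omega>))" if "j \<in> {..<n}" for j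
        using that by (intro integrable_mult_right square_integrable_mult \<Delta>) auto
      then show "expectation (\<lambda>\<omega>. \<Sum>j<n. \<beta> i * \<beta> j * (\<Delta> i \<omega> * \<Delta> j \<omega>))
          = (\<Sum>j<n. \<beta> i * \<beta> j * expectation (\<lambda>\<omega>. \<Delta> i \<omega> * \<Delta> j \<omega>))"
        by (subst Bochner_Integration.integral_sum) simp_all
    qed
  qed
  finally show ?thesis
    using integral_Cauchy_Schwarz[OF Z2 Y2] by (simp add: 1 R)
qed

text \<open>The duality estimate for one subdivision \<open>p\<close> yields the grid sum with
  \<open>p\<close> in both directions, which is among those in the supremum
  \<open>var_2d\<close>.\<close>

lemma (in prob_space) cameron_martin_variation_bound:
  assumes X: "gaussian_process M X" and Z: "represents M X Z h" and "1 \<le> \<rho>"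
    and "0 \<le> s" "t \<le> 1" and fin: "var_2d \<rho> (covariance M X) s t s t < \<infinity>"
  shows "var_1d \<rho> h s t \<le>
    ennreal (sqrt (cm_inner M X h h) * sqrt (enn2real (var_2d \<rho> (covariance M X) s t s t)))"
  unfolding var_1d_def
proof (rule SUP_least, clarify, rule ennreal_leI)
  fix n p assume p: "(n, p) \<in> subdivisions s t"
  let ?V = "(\<Sum>i<n. \<Sum>j<n.
    \<bar>rect_incr (covariance M X) (p i) (p (Suc i)) (p j) (p (Suc j))\<bar> powr \<rho>) powr (1 / \<rho>)"
  have "p i \<in> {0..1}" if "i \<le> n" for i
    using subdivisions_mem[OF p that] \<open>0 \<le> s\<close> \<open>t \<le> 1\<close> by auto
  then have "(\<Sum>i<n. \<bar>h (p (Suc i)) - h (p i)\<bar> powr \<rho>) powr (1 / \<rho>)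
      \<le> sqrt (expectation (\<lambda>\<omega>. (Z \<omega>)\<^sup>2)) * sqrt ?V"
    using \<open>1 \<le> \<rho>\<close>
    by (intro powr_sum_le_of_quadratic_bound represents_quadratic_bound[OF X Z]) auto
  also have "\<dots> \<le> sqrt (expectation (\<lambda>\<omega>. (Z \<omega>)\<^sup>2)) * sqrt (enn2real (var_2d \<rho> (covariance M X) s t s t))"
  proof (intro mult_left_mono real_sqrt_le_mono)
    \<comment> \<open>Finiteness is essential here: \<open>enn2real\<close> sends infinity to 0 and
      is monotone only below a finite bound.\<close>
    have "enn2real (ennreal ?V) \<le> enn2real (var_2d \<rho> (covariance M X) s t s t)"
      using fin by (intro enn2real_mono var_2d_upper[OF p p]) auto
    then show "?V \<le> enn2real (var_2d \<rho> (covariance M X) s t s t)"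
      by simp
  qed simp
  finally show "(\<Sum>i<n. \<bar>h (p (Suc i)) - h (p i)\<bar> powr \<rho>) powr (1 / \<rho>) \<le>
      sqrt (cm_inner M X h h) * sqrt (enn2real (var_2d \<rho> (covariance M X) s t s t))"
    by (simp add: cm_inner_self[OF X Z])
qed

text \<open>Cauchy-Schwarz bounds \<open>\<bar>h (u n) - h a\<bar>\<close> by the
  \<open>L\<^sup>2\<close> norms of \<open>Z\<close> and of \<open>X (u n) - X a\<close>. Sequences
  are used because the mean-square limit rests on dominated convergence.\<close>

lemma (in prob_space) cameron_martin_continuous:
  assumes X: "gaussian_process M X" and Z: "represents M X Z h"
    and mean: "\<And>t. t \<in> {0..1} \<Longrightarrow> expectation (X t) = 0"
    and cont: "\<And>\<omega>. \<omega> \<in> space M \<Longrightarrow> continuous_on {0..1} (\<lambda>t. X t \<omega>)"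
  shows "continuous_on {0..1} h"
proof (rule continuous_on_sequentiallyI)
  fix u :: "nat \<Rightarrow> real" and a
  assume "\<forall>n. u n \<in> {0..1}" and a: "a \<in> {0..1}" and "u \<longlonglongrightarrow> a"
  then have u: "u n \<in> {0..1}" for n
    by auto
  define Y where "Y n \<omega> = X (u n) \<omega> - X a \<omega>" for n \<omega>
  have Z2: "square_integrable M Z"
    using Z closed_linear_span_square_integrable by (auto simp: represents_def)
  have X2: "square_integrable M (X t)" if "t \<in> {0..1}" for t
    by (rule gaussian_process_square_integrable[OF X that])
  \<comment> \<open>On a probability space square-integrability implies integrability, which lets
    the expectation of an increment split into a difference of zero means.\<close>
  have X1: "integrable M (X t)" if "t \<in> {0..1}" for t
    using X2[OF that] square_integrable_imp_integrable by (auto simp: square_integrable_def)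
  have Y2: "square_integrable M (Y n)" for n
    unfolding Y_def[abs_def] by (intro square_integrable_diff X2 u a)
  have "(\<lambda>n. expectation (\<lambda>\<omega>. (Y n \<omega>)\<^sup>2)) \<longlonglongrightarrow> 0"
  proof (rule centered_gaussian_second_moment_LIMSEQ)
    show "gaussian M (Y n)" for n
      using X linear_span_diff_member[OF u a] by (auto simp: gaussian_process_def Y_def[abs_def])
    show "expectation (Y n) = 0" for n
      using X1[OF u] X1[OF a] mean[OF u] mean[OF a] by (simp add: Y_def[abs_def])
    show "(\<lambda>n. Y n \<omega>) \<longlonglongrightarrow> 0" if "\<omega> \<in> space M" for \<omega>
    proof -
      have "(\<lambda>n. X (u n) \<omega>) \<longlonglongrightarrow> X a \<omega>"
        using continuous_on_tendsto_compose[OF cont[OF that] \<open>u \<longlonglongrightarrow> a\<close> a] u by auto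
      then show ?thesis
        unfolding Y_def using LIM_zero by blast
    qed
  qed
  then have "(\<lambda>n. sqrt (expectation (\<lambda>\<omega>. (Z \<omega>)\<^sup>2) * expectation (\<lambda>\<omega>. (Y n \<omega>)\<^sup>2)))
      \<longlonglongrightarrow> sqrt (expectation (\<lambda>\<omega>. (Z \<omega>)\<^sup>2) * 0)"
    by (intro tendsto_intros)
  then have lim: "(\<lambda>n. sqrt (expectation (\<lambda>\<omega>. (Z \<omega>)\<^sup>2) * expectation (\<lambda>\<omega>. (Y n \<omega>)\<^sup>2))) \<longlonglongrightarrow> 0"
    by simp
  have "h (u n) - h a = expectation (\<lambda>\<omega>. Z \<omega> * Y n \<omega>)" for n
    using Z u[of n] a square_integrable_mult[OF Z2 X2[OF u[of n]]] square_integrable_mult[OF Z2 X2[OF a]]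
    by (simp add: represents_def Y_def right_diff_distrib)
  then have "\<bar>h (u n) - h a\<bar> \<le> sqrt (expectation (\<lambda>\<omega>. (Z \<omega>)\<^sup>2) * expectation (\<lambda>\<omega>. (Y n \<omega>)\<^sup>2))" for n
    using integral_Cauchy_Schwarz[OF Z2 Y2[of n]] by (intro real_le_rsqrt) simp
  then have "(\<lambda>n. h (u n) - h a) \<longlonglongrightarrow> 0"
    by (intro Lim_null_comparison[OF _ lim]) auto
  then show "(\<lambda>n. h (u n)) \<longlonglongrightarrow> h a"
    by (rule LIM_zero_cancel)
qed

theorem proposition16:
  fixes M :: "'a measure" and X :: "real \<Rightarrow> 'a \<Rightarrow> real" and \<rho> :: real
  assumes "prob_space M"
    and "gaussian_process M X"
    and "\<forall>t\<in>{0..1}. (\<integral>\<omega>. X t \<omega> \<partial>M) = 0"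
    and "\<forall>\<omega>\<in>space M. continuous_on {0..1} (\<lambda>t. X t \<omega>)"
    and "\<rho> \<ge> 1"
    and "finite_var_2d \<rho> (covariance M X)"
  shows "cameron_martin M X \<subseteq> C_var \<rho> \<and>
    (\<forall>h\<in>cameron_martin M X. \<forall>s t. 0 \<le> s \<and> s < t \<and> t \<le> 1 \<longrightarrow>
       var_1d \<rho> h s t \<le>
         ennreal (sqrt (cm_inner M X h h) * sqrt (enn2real (var_2d \<rho> (covariance M X) s t s t))))"
proof -
  interpret prob_space M
    by fact
  have bound: "var_1d \<rho> h s t \<le>
      ennreal (sqrt (cm_inner M X h h) * sqrt (enn2real (var_2d \<rho> (covariance M X) s t s t)))"
    if "represents M X Z h" "0 \<le> s" "t \<le> 1" for h Z s t
  proof (rule cameron_martin_variation_bound)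
    have "var_2d \<rho> (covariance M X) s t s t \<le> var_2d \<rho> (covariance M X) 0 1 0 1"
      using assms that by (intro var_2d_mono) auto
    also have "\<dots> < \<infinity>"
      using assms by (simp add: finite_var_2d_def)
    finally show "var_2d \<rho> (covariance M X) s t s t < \<infinity>" .
  qed (use assms that in auto)
  \<comment> \<open>At \<open>s = 0\<close> and \<open>t = 1\<close> the right side of
    \<open>bound\<close> is \<open>ennreal\<close> of a real number, so the variation of
    \<open>h\<close> is finite.\<close>
  have "h \<in> C_var \<rho>" if Z: "represents M X Z h" for h Z
    unfolding C_var_def
    using cameron_martin_continuous[OF assms(2) Z] bound[OF Z, of 0 1] assms
    by (auto simp: order_le_less_trans)
  with bound show ?thesis
    by (auto simp: cameron_martin_def)
qed

end
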